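(* Let $\{a_n\}$ be a sequence of positive rational numbers, indexed by $n \in \mathbb{N}$, satisfying that $\gcd(\mathsf{d}(a_i), \mathsf{d}(a_j)) = 1$ for any $i \neq j$. Then the Puiseux monoid $\langle a_n \mid n \in \mathbb{N} \rangle$ is atomic but not strongly primary.
   Context: $\mathbb{N}$ is the set of positive integers and $\mathbb{N}_0 = \mathbb{N} \cup \{0\}$. For $q \in \mathbb{Q}_{>0}$, $\mathsf{d}(q)$ is the denominator of $q$ in lowest terms, that is, $q = a/b$ with $a, b \in \mathbb{N}$, $\gcd(a,b) = 1$ and $\mathsf{d}(q) = b$. A Puiseux monoid is an additive submonoid of $\mathbb{Q}_{\ge 0}$; $\langle S \rangle$ is the smallest submonoid containing $S$. Let $M$ be a reduced additive commutative cancellative monoid (its only unit is $0$), and let $M^\bullet = M \setminus \{0\}$. An atom of $M$ is an element $a \in M^\bullet$ such that $a = u+v$ with $u, v \in M$ implies $u = 0$ or $v = 0$. $M$ is atomic if it is generated by its atoms. For $x \in M$, $\mathsf{L}(x)$ is the set of all $\ell \in \mathbb{N}_0$ such that $x$ is a sum of $\ell$ atoms (counted with repetition). $M$ is a BF-monoid if $\mathsf{L}(x)$ is a finite set for all $x \in M$. For $a, b \in M$, $a \mid_M b$ means that $b = a + c$ for some $c \in M$. A submonoid $S$ of $M$ is divisor-closed if for all $x \in M$ and $s \in S$, $x \mid_M s$ implies $x \in S$. $M$ is primary if it is nontrivial and its only divisor-closed submonoids are $\{0\}$ and $M$. $M$ is finitary if it is a BF-monoid and there exist $n \in \mathbb{N}$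 and a finite subset $S \subseteq M^\bullet$ such that $nM^\bullet \subseteq S + M$, where $nM^\bullet = \{nx \mid x \in M^\bullet\}$. $M$ is strongly primary if it is both primary and finitary.
   Formalization: "Not strongly primary" is proved assuming that infinitely many a_n are non-integers; without this it fails (a_n = 1 for all n gives N_0, which is strongly primary). Atomicity is proved exactly as stated. *)

theory Defs
  imports Complex_Main "HOL-Library.Multiset" "HOL-Library.Set_Algebras"
begin

text \<open>
  A reduced commutative cancellative monoid is represented by its carrier \<open>M\<close>, a
  submonoid of an ambient type of class \<open>cancel_comm_monoid_add\<close>.  The definitions
  below that take \<open>M\<close> are meant for carriers with \<open>submonoid M\<close> in which \<open>0\<close> is the
  only unit; for Puiseux monoids the ambient type is \<open>rat\<close>.
\<close>

definition submonoid :: "'a::cancel_comm_monoid_add set \<Rightarrow> bool" where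
  "submonoid M \<longleftrightarrow> 0 \<in> M \<and> (\<forall>x\<in>M. \<forall>y\<in>M. x + y \<in> M)"

definition generated :: "'a::cancel_comm_monoid_add set \<Rightarrow> 'a set" where
  "generated S = submonoid hull S"

definition atoms :: "'a::cancel_comm_monoid_add set \<Rightarrow> 'a set" where
  "atoms M = {a \<in> M - {0}. \<forall>u\<in>M. \<forall>v\<in>M. a = u + v \<longrightarrow> u = 0 \<or> v = 0}"

definition atomic :: "'a::cancel_comm_monoid_add set \<Rightarrow> bool" where
  "atomic M \<longleftrightarrow> generated (atoms M) = M"

definition lengths :: "'a::cancel_comm_monoid_add set \<Rightarrow> 'a \<Rightarrow> nat set" where
  "lengths M x = {l. \<exists>F. set_mset F \<subseteq> atoms M \<and> sum_mset F = x \<and> size F = l}"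

definition BF_monoid :: "'a::cancel_comm_monoid_add set \<Rightarrow> bool" where
  "BF_monoid M \<longleftrightarrow> (\<forall>x\<in>M. finite (lengths M x))"

definition divides_in :: "'a::cancel_comm_monoid_add set \<Rightarrow> 'a \<Rightarrow> 'a \<Rightarrow> bool" where
  "divides_in M a b \<longleftrightarrow> (\<exists>c\<in>M. b = a + c)"

definition divisor_closed :: "'a::cancel_comm_monoid_add set \<Rightarrow> 'a set \<Rightarrow> bool" where
  "divisor_closed M S \<longleftrightarrow> submonoid S \<and> S \<subseteq> M \<and>
     (\<forall>x\<in>M. \<forall>s\<in>S. divides_in M x s \<longrightarrow> x \<in> S)"

definition primary :: "'a::cancel_comm_monoid_add set \<Rightarrow> bool" where
  "primary M \<longleftrightarrow> M \<noteq> {0} \<and> (\<forall>S. divisor_closed M S \<longrightarrow> S = {0} \<or> S = M)"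

text \<open>
  In a general commutative monoid the multiple \<open>n x\<close> is the \<open>n\<close>-fold sum
  \<open>\<Sum>i<n. x\<close>; the sum of sets \<open>S + M\<close> is the elementwise one.
\<close>

definition finitary :: "'a::cancel_comm_monoid_add set \<Rightarrow> bool" where
  "finitary M \<longleftrightarrow> BF_monoid M \<and>
     (\<exists>(n::nat) S. n \<ge> 1 \<and> finite S \<and> S \<subseteq> M - {0} \<and>
        (\<lambda>x. \<Sum>i<n. x) ` (M - {0}) \<subseteq> S + M)"

definition strongly_primary :: "'a::cancel_comm_monoid_add set \<Rightarrow> bool" where
  "strongly_primary M \<longleftrightarrow> primary M \<and> finitary M"

definition puiseux_monoid :: "rat set \<Rightarrow> bool" where
  "puiseux_monoid M \<longleftrightarrow> submonoid M \<and> M \<subseteq> {0..}"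

text \<open>\<open>quotient_of\<close> returns lowest terms with positive denominator; integers have \<open>denom\<close> \<open>1\<close>.\<close>

definition denom :: "rat \<Rightarrow> int" where
  "denom q = snd (quotient_of q)"

lemma submonoid_generated: "submonoid (generated S)"
  unfolding generated_def submonoid_def hull_def by auto

lemma puiseux_monoid_generated:
  assumes "S \<subseteq> {0..}"
  shows "puiseux_monoid (generated S)"
proof -
  have "generated S \<subseteq> {0..}"
    unfolding generated_def by (rule hull_minimal) (auto simp: assms submonoid_def)
  then show ?thesis by (simp add: puiseux_monoid_def submonoid_generated)
qed

end

theory Submission
  imports Defs
begin

text \<open>
  Fix an index \<open>k\<close> and let \<open>d\<close> be the denominator of \<open>a k\<close>.  All other generators lie in the
  group of rationals that have a denominator coprime to \<open>d\<close>, whereas \<open>c * a k\<close> lies in this group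
  only if \<open>d\<close> divides \<open>c\<close>.  Hence the coefficient of \<open>a k\<close> in a representation of an element by
  the generators is determined modulo \<open>d\<close>.  If \<open>n < d\<close>, positivity then leaves no freedom at all:
  \<open>n * a k\<close> has only one representation, so its divisors in the monoid are the multiples
  \<open>j * a k\<close> with \<open>j \<le> n\<close> (\<open>summands_of_multiple\<close>).

  With \<open>n = 1\<close> this shows that every non-integral generator is an atom.  The integral generators
  may fail to be atoms, but they are positive integers, so splitting them repeatedly
  into smaller generators must stop; this gives atomicity.

  If \<open>n M\<^sup>\<bullet> \<subseteq> S + M\<close> with \<open>S\<close> finite, then for every \<open>k\<close> whose denominator exceeds \<open>n\<close> the set
  \<open>S\<close> contains some \<open>j * a k\<close> with \<open>1 \<le> j \<le> n\<close>.  Distinct \<open>k\<close> and \<open>l\<close> cannot share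
  such an element: a multiple of \<open>a l\<close> has a denominator coprime to that of \<open>a k\<close>, and \<open>j * a k\<close>
  has not, as \<open>j\<close> is too small to be divisible by it.  Infinitely many
  non-integral generators with pairwise coprime denominators yield infinitely many such \<open>k\<close>, so
  \<open>S\<close> cannot be finite.  Thus the monoid is not even finitary.
\<close>

section \<open>Generated submonoids\<close>

lemma generated_base: "x \<in> S \<Longrightarrow> x \<in> generated S"
  unfolding generated_def by (rule hull_inc)

lemma generated_zero: "0 \<in> generated S"
  using submonoid_generated[of S] by (simp add: submonoid_def)

lemma generated_add: "x \<in> generated S \<Longrightarrow> y \<in> generated S \<Longrightarrow> x + y \<in> generated S"
  using submonoid_generated[of S] by (simp add: submonoid_def)

lemma generated_least: "S \<subseteq> T \<Longrightarrow> submonoid T \<Longrightarrow> generated S \<subseteq> T"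
  unfolding generated_def by (rule hull_minimal)

lemma generated_induct [consumes 1, case_names zero base add]:
  assumes "x \<in> generated S" "P 0" "\<And>x. x \<in> S \<Longrightarrow> P x"
    "\<And>x y. x \<in> generated S \<Longrightarrow> y \<in> generated S \<Longrightarrow> P x \<Longrightarrow> P y \<Longrightarrow> P (x + y)"
  shows "P x"
proof -
  have "generated S \<subseteq> {x \<in> generated S. P x}"
    by (rule generated_least)
      (auto simp: submonoid_def assms generated_base generated_zero generated_add)
  then show ?thesis using assms(1) by blast
qed

lemma generated_nonneg:
  assumes "S \<subseteq> {0..}" "x \<in> generated S"
  shows "(x::rat) \<ge> 0"
  using puiseux_monoid_generated[OF assms(1)] assms(2) by (auto simp: puiseux_monoid_def)

text \<open>All generators are nonnegative, so a generator that exceeds \<open>x\<close> cannot occur in \<open>x\<close>.\<close>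

lemma generated_by_smaller:
  fixes x :: rat
  assumes "S \<subseteq> {0..}" "x \<in> generated S" "x < b"
  shows "x \<in> generated {s \<in> S. s < b}"
  using assms(2,3)
proof (induction rule: generated_induct)
  case (add x y)
  then have "x \<ge> 0" "y \<ge> 0" using generated_nonneg[OF assms(1)] by auto
  with add show ?case by (auto intro!: generated_add)
qed (auto intro: generated_zero generated_base)

lemma generated_insert_split:
  fixes x g :: "'a::{cancel_comm_monoid_add, semiring_1}"
  assumes "x \<in> generated (insert g S)"
  shows "\<exists>c y. x = of_nat c * g + y \<and> y \<in> generated S"
  using assms
proof (induction rule: generated_induct)
  case zero
  show ?case by (rule exI[of _ 0]) (auto intro: generated_zero)
next
  case (base x)
  then consider "x = g" | "x \<in> S" by auto
  then show ?case
  proof cases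
    case 1
    then show ?thesis by (intro exI[of _ 1] exI[of _ 0]) (auto intro: generated_zero)
  next
    case 2
    then show ?thesis by (intro exI[of _ 0] exI[of _ x]) (auto intro: generated_base)
  qed
next
  case (add x x')
  then obtain c y c' y' where "x = of_nat c * g + y" "y \<in> generated S"
    "x' = of_nat c' * g + y'" "y' \<in> generated S" by blast
  then show ?case
    by (intro exI[of _ "c + c'"] exI[of _ "y + y'"]) (auto simp: algebra_simps intro: generated_add)
qed

section \<open>Rationals with denominator coprime to a given integer\<close>

text \<open>
  For prime \<open>d\<close> this is the localization of the integers at \<open>d\<close>.  Asking for some multiplier
  coprime to \<open>d\<close>, instead of the reduced denominator, makes closure under addition immediate.
\<close>

definition integral_at :: "int \<Rightarrow> rat set" where
  "integral_at d = {q. \<exists>m. coprime m d \<and> of_int m * q \<in> \<int>}"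

lemma integral_at_zero: "0 \<in> integral_at d"
  by (auto simp: integral_at_def intro!: exI[of _ 1])

lemma integral_at_add:
  assumes "x \<in> integral_at d" "y \<in> integral_at d"
  shows "x + y \<in> integral_at d"
proof -
  obtain m n where m: "coprime m d" "of_int m * x \<in> \<int>" and n: "coprime n d" "of_int n * y \<in> \<int>"
    using assms by (auto simp: integral_at_def)
  have "of_int (m * n) * (x + y) = of_int n * (of_int m * x) + of_int m * (of_int n * y)"
    by (simp add: algebra_simps)
  also have "\<dots> \<in> \<int>" using Ints_add[OF Ints_mult[OF Ints_of_int m(2)] Ints_mult[OF Ints_of_int n(2)]] .
  finally show ?thesis using m n by (auto simp: integral_at_def intro!: exI[of _ "m * n"])
qed

lemma integral_at_of_nat_mult: "x \<in> integral_at d \<Longrightarrow> of_nat c * x \<in> integral_at d"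
  by (induction c) (auto simp: integral_at_zero algebra_simps intro: integral_at_add)

lemma submonoid_integral_at: "submonoid (integral_at d)"
  by (simp add: submonoid_def integral_at_zero integral_at_add)

lemma denom_pos: "denom q > 0"
  by (simp add: denom_def quotient_of_denom_pos')

lemma denom_fractionE:
  obtains p where "q = of_int p / of_int (denom q)" "coprime p (denom q)"
proof (rule that)
  show "q = of_int (fst (quotient_of q)) / of_int (denom q)"
    unfolding denom_def by (rule quotient_of_div) simp
  show "coprime (fst (quotient_of q)) (denom q)"
    unfolding denom_def by (rule quotient_of_coprime) simp
qed

lemma integral_at_denom:
  assumes "coprime (denom q) d"
  shows "q \<in> integral_at d"
proof -
  obtain p where p: "q = of_int p / of_int (denom q)" by (rule denom_fractionE)
  have "denom q \<noteq> 0" using denom_pos[of q] by simp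
  then have "of_int (denom q) * q = of_int p" by (subst (2) p) simp
  then show ?thesis using assms by (auto simp: integral_at_def)
qed

text \<open>
  Cancellation by the numerator and by the multiplier, both coprime to the denominator.
\<close>

lemma denom_dvd_multiplier:
  assumes "of_int c * q \<in> integral_at (denom q)"
  shows "denom q dvd c"
proof -
  obtain p where p: "q = of_int p / of_int (denom q)" "coprime p (denom q)"
    by (rule denom_fractionE)
  obtain m z where m: "coprime m (denom q)" "of_int m * (of_int c * q) = of_int z"
    using assms by (auto simp: integral_at_def elim!: Ints_cases)
  have "denom q \<noteq> 0" using denom_pos[of q] by simp
  then have "q * of_int (denom q) = of_int p" by (subst (1) p(1)) simp
  then have "(of_int (m * c * p) :: rat) = of_int m * (of_int c * q) * of_int (denom q)"
    by (simp add: mult.assoc)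
  also have "\<dots> = of_int (z * denom q)" using m(2) by simp
  finally have "m * c * p = z * denom q" by (simp only: of_int_eq_iff)
  then have "denom q dvd m * c * p" by simp
  then show ?thesis using p(2) m(1)
    by (metis coprime_commute coprime_dvd_mult_left_iff coprime_dvd_mult_right_iff)
qed

section \<open>Generators with pairwise coprime denominators\<close>

locale coprime_denominators =
  fixes a :: "nat \<Rightarrow> rat"
  assumes pos: "\<And>n. a n > 0"
    and coprime: "\<And>i j. i \<noteq> j \<Longrightarrow> coprime (denom (a i)) (denom (a j))"
begin

lemma range_nonneg: "range a \<subseteq> {0..}"
  using pos by (auto intro: less_imp_le)

lemma split_off:
  assumes "x \<in> generated (range a)"
  obtains c y where "x = of_nat c * a k + y" "y \<ge> 0" "y \<in> integral_at (denom (a k))"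
proof -
  have "range a = insert (a k) (a ` (- {k}))" by auto
  with assms obtain c y where "x = of_nat c * a k + y" and y: "y \<in> generated (a ` (- {k}))"
    using generated_insert_split by metis
  moreover have "y \<ge> 0"
    using y by (rule generated_nonneg[rotated]) (use range_nonneg in auto)
  moreover have "generated (a ` (- {k})) \<subseteq> integral_at (denom (a k))"
    by (rule generated_least)
      (auto intro!: integral_at_denom coprime submonoid_integral_at)
  ultimately show ?thesis using y that by blast
qed

text \<open>
  The coefficients of \<open>a k\<close> in \<open>s\<close> and \<open>t\<close> add up to a number that is congruent to \<open>n\<close> modulo the
  denominator and at most \<open>n\<close>, hence to \<open>n\<close>; nothing is left for the other generators.
\<close>

lemma summands_of_multiple:
  assumes "s \<in> generated (range a)" "t \<in> generated (range a)"
    and "of_nat n * a k = s + t" "int n < denom (a k)"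
  obtains i j where "s = of_nat i * a k" "t = of_nat j * a k" "i + j = n"
proof -
  obtain i y where s: "s = of_nat i * a k + y" "y \<ge> 0" "y \<in> integral_at (denom (a k))"
    using assms(1) by (rule split_off)
  obtain j z where t: "t = of_nat j * a k + z" "z \<ge> 0" "z \<in> integral_at (denom (a k))"
    using assms(2) by (rule split_off)
  define c where "c = int n - int i - int j"
  have eq: "of_int c * a k = y + z"
    using assms(3) s t by (simp add: c_def algebra_simps)
  then have "denom (a k) dvd c"
    using integral_at_add[OF s(3) t(3)] by (intro denom_dvd_multiplier) simp
  moreover have "c \<ge> 0"
  proof -
    have "0 \<le> of_int c * a k" using eq s t by simp
    then show ?thesis using pos[of k] by (simp add: zero_le_mult_iff)
  qed
  moreover have "c < denom (a k)" using assms(4) by (simp add: c_def)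
  ultimately have c: "c = 0" using zdvd_imp_le[of "denom (a k)" c] by linarith
  then have "y = 0" "z = 0" using eq s t by auto
  moreover have "i + j = n" using c by (simp add: c_def)
  ultimately show ?thesis using that[of i j] s(1) t(1) by simp
qed

lemma nonintegral_generator_atom:
  assumes "denom (a k) \<noteq> 1"
  shows "a k \<in> atoms (generated (range a))"
proof -
  have less: "int 1 < denom (a k)" using assms denom_pos[of "a k"] by simp
  have "u = 0 \<or> v = 0"
    if uv: "u \<in> generated (range a)" "v \<in> generated (range a)" "a k = u + v" for u v
  proof -
    have eq: "of_nat 1 * a k = u + v" using uv by simp
    obtain i j :: nat where "u = of_nat i * a k" "v = of_nat j * a k" "i + j = 1"
      using uv(1,2) eq less by (rule summands_of_multiple)
    then show ?thesis by (cases i) auto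
  qed
  then show ?thesis
    using pos[of k] by (auto simp: atoms_def intro: generated_base)
qed

text \<open>
  If an integral generator is the sum of two nonzero elements, both are built from generators
  smaller than it.  Among these, the non-integral ones are atoms and the integral ones are smaller
  positive integers, so induction on the integer part applies.
\<close>

lemma generator_in_generated_atoms: "a n \<in> generated (atoms (generated (range a)))"
proof (induction "nat \<lfloor>a n\<rfloor>" arbitrary: n rule: less_induct)
  case less
  let ?M = "generated (range a)"
  show ?case
  proof (cases "a n \<in> atoms ?M")
    case True
    then show ?thesis by (rule generated_base)
  next
    case False
    then have int_n: "denom (a n) = 1" using nonintegral_generator_atom by blast
    have smaller: "a i \<in> generated (atoms ?M)" if "a i < a n" for i
    proof (cases "denom (a i) = 1")
      case True
      obtain p q where "a i = of_int p" "a n = of_int q"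
        using denom_fractionE[of "a i"] denom_fractionE[of "a n"] True int_n by (metis div_by_1 of_int_1)
      then have "nat \<lfloor>a i\<rfloor> < nat \<lfloor>a n\<rfloor>" using that pos[of n] by simp
      then show ?thesis by (rule less)
    next
      case False
      then show ?thesis by (intro generated_base nonintegral_generator_atom)
    qed
    have below: "x \<in> generated (atoms ?M)" if "x \<in> ?M" "x < a n" for x
    proof -
      have "x \<in> generated {s \<in> range a. s < a n}"
        using range_nonneg that by (rule generated_by_smaller)
      moreover have "generated {s \<in> range a. s < a n} \<subseteq> generated (atoms ?M)"
        by (rule generated_least) (auto intro: smaller submonoid_generated)
      ultimately show ?thesis by blast
    qed
    have "a n \<in> ?M" "a n \<noteq> 0" using pos[of n] by (auto intro: generated_base)
    with False obtain u v where uv: "u \<in> ?M" "v \<in> ?M" "a n = u + v" "u \<noteq> 0" "v \<noteq> 0"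
      by (auto simp: atoms_def)
    then have "u > 0" "v > 0"
      using generated_nonneg[OF range_nonneg] by (simp_all add: order_less_le)
    then show ?thesis using uv below[of u] below[of v] by (auto intro: generated_add)
  qed
qed

lemma atomic_generated: "atomic (generated (range a))"
  unfolding atomic_def
proof
  show "generated (atoms (generated (range a))) \<subseteq> generated (range a)"
    by (rule generated_least) (auto simp: atoms_def submonoid_generated)
  show "generated (range a) \<subseteq> generated (atoms (generated (range a)))"
    by (rule generated_least) (auto simp: generator_in_generated_atoms submonoid_generated)
qed

text \<open>
  Coprimality makes the denominators different from 1 distinct, so only finitely many of them lie
  below a given bound.
\<close>

lemma infinite_large_denominators:
  assumes "infinite {k. denom (a k) \<noteq> 1}"
  shows "infinite {k. int n < denom (a k)}"
proof
  assume fin: "finite {k. int n < denom (a k)}"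
  let ?B = "{k. denom (a k) \<noteq> 1 \<and> denom (a k) \<le> int n}"
  have "inj_on (\<lambda>k. denom (a k)) ?B"
  proof (rule inj_onI)
    fix i j assume ij: "i \<in> ?B" "j \<in> ?B" "denom (a i) = denom (a j)"
    show "i = j"
    proof (rule ccontr)
      assume "i \<noteq> j"
      then have "coprime (denom (a i)) (denom (a i))" using coprime[of i j] ij(3) by simp
      then show False using ij(1) denom_pos[of "a i"] by (simp add: coprime_self)
    qed
  qed
  moreover have "(\<lambda>k. denom (a k)) ` ?B \<subseteq> {0..int n}"
    by (auto simp: less_imp_le[OF denom_pos])
  ultimately have "finite ?B" by (meson finite_atLeastAtMost_int inj_on_finite)
  then have "finite (?B \<union> {k. int n < denom (a k)})" using fin by simp
  moreover have "{k. denom (a k) \<noteq> 1} \<subseteq> ?B \<union> {k. int n < denom (a k)}" by auto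
  ultimately show False using assms finite_subset by blast
qed

lemma multiples_distinct:
  assumes "k \<noteq> l" "0 < i" "int i < denom (a k)"
  shows "of_nat i * a k \<noteq> of_nat j * a l"
proof
  assume eq: "of_nat i * a k = of_nat j * a l"
  have "of_nat j * a l \<in> integral_at (denom (a k))"
    using assms(1) by (intro integral_at_of_nat_mult integral_at_denom coprime) auto
  then have "of_int (int i) * a k \<in> integral_at (denom (a k))" using eq by simp
  then have "denom (a k) dvd int i" by (rule denom_dvd_multiplier)
  then show False using assms zdvd_imp_le by fastforce
qed

lemma not_finitary:
  assumes "infinite {k. denom (a k) \<noteq> 1}"
  shows "\<not> finitary (generated (range a))"
proof
  let ?M = "generated (range a)"
  assume "finitary ?M"
  then obtain n :: nat and S where S: "finite S" "S \<subseteq> ?M - {0}"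
    and sub: "(\<lambda>x. \<Sum>i<n. x) ` (?M - {0}) \<subseteq> S + ?M"
    unfolding finitary_def by blast
  let ?K = "{k. int n < denom (a k)}"
  have "\<exists>i. 0 < i \<and> i \<le> n \<and> of_nat i * a k \<in> S" if k: "k \<in> ?K" for k
  proof -
    have "a k \<in> ?M - {0}" using pos[of k] by (auto intro: generated_base)
    then have "of_nat n * a k \<in> S + ?M" using sub by auto
    then obtain s t where st: "s \<in> S" "t \<in> ?M" "of_nat n * a k = s + t"
      by (auto elim: set_plus_elim)
    have less: "int n < denom (a k)" and sM: "s \<in> ?M" using k st S by auto
    obtain i j where "s = of_nat i * a k" "i + j = n"
      using sM st(2,3) less by (rule summands_of_multiple)
    moreover have "s \<noteq> 0" using st S by auto
    ultimately show ?thesis using st by (intro exI[of _ i]) auto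
  qed
  then obtain f where f: "\<And>k. k \<in> ?K \<Longrightarrow> 0 < f k \<and> f k \<le> n \<and> of_nat (f k) * a k \<in> S"
    by metis
  have "inj_on (\<lambda>k. of_nat (f k) * a k) ?K"
  proof (rule inj_onI, rule ccontr)
    fix k l assume kl: "k \<in> ?K" "l \<in> ?K" "of_nat (f k) * a k = of_nat (f l) * a l" "k \<noteq> l"
    have "0 < f k" "int (f k) < denom (a k)" using f[OF kl(1)] kl(1) by auto
    then show False using multiples_distinct[OF kl(4)] kl(3) by blast
  qed
  moreover have "(\<lambda>k. of_nat (f k) * a k) ` ?K \<subseteq> S" using f by blast
  ultimately have "finite ?K" using S(1) by (rule inj_on_finite)
  then show False using infinite_large_denominators[OF assms] by blast
qed

end

theorem proposition5p7:
  fixes a :: "nat \<Rightarrow> rat"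
  assumes "\<And>n. a n > 0"
    and "\<And>i j. i \<noteq> j \<Longrightarrow> gcd (denom (a i)) (denom (a j)) = 1"
  shows "atomic (generated (range a)) \<and>
    (infinite {n. denom (a n) \<noteq> 1} \<longrightarrow> \<not> strongly_primary (generated (range a)))"
proof -
  interpret coprime_denominators a
    using assms by unfold_locales (auto simp: coprime_iff_gcd_eq_1)
  show ?thesis
    using atomic_generated not_finitary by (auto simp: strongly_primary_def)
qed

end
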